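(* Let $G$ and $H$ be finite simple graphs, and suppose that $H$ contains a vertex of even degree (in $H$). Then the corona product $G\odot H$, with center graph $G$ and outer graph $H$, admits an antimagic orientation.
   Context: All graphs are finite and simple, and are not assumed to be connected. Corona product: given graphs $G$ and $H$, the corona product $G\odot H$ is the graph obtained by taking one copy of $G$ (the center graph) and $|V(G)|$ disjoint copies of $H$ (the outer graphs), one copy for each vertex of $G$, and joining each vertex of $G$ to every vertex of its corresponding copy of $H$. Explicitly, if $V(G)=\{v_1,\ldots,v_n\}$ and $V(H)=\{u_1,\ldots,u_k\}$, then $V(G\odot H)=\{v_1,\ldots,v_n\}\cup\{u_j^{(i)}\mid 1\le i\le n,\ 1\le j\le k\}$ and $E(G\odot H)=E(G)\cup\{u_j^{(i)}u_{j'}^{(i)}\mid 1\le i\le n,\ u_ju_{j'}\in E(H)\}\cup\{v_iu_j^{(i)}\mid 1\le i\le n,\ 1\le j\le k\}$. Antimagic orientation: let $F$ be a graph, let $D$ be an orientation of $F$ (each edge of $F$ is assigned one of its two directions), and let $\tau:E(F)\to\{1,2,\ldots,|E(F)|\}$ be a bijection. The vertex sum $s_{(D,\tau)}(v)$ of a vertex $v\in V(F)$ is the sum of the labels $\tau(e)$ of all edges $e$ entering $v$ under $D$ minus the sum of the labels $\tau(e)$ of all edges $e$ leaving $v$ under $D$; the vertex sum of an isolated vertex is $0$. The graph $F$ admits an antimagic orientation if there exist an orientation $D$ of $F$ and a bijection $\tau:E(F)\to\{1,2,\ldots,|E(F)|\}$ such that the vertex sums $s_{(D,\tau)}(v)$,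 $v\in V(F)$, are pairwise distinct. *)

theory Defs
  imports Main
begin

record 'a ugraph =
  verts :: "'a set"
  edges :: "'a set set"

definition simple_graph :: "'a ugraph \<Rightarrow> bool" where
  "simple_graph G \<longleftrightarrow> finite (verts G) \<and> (\<forall>e \<in> edges G. e \<subseteq> verts G \<and> card e = 2)"

definition degree :: "'a ugraph \<Rightarrow> 'a \<Rightarrow> nat" where
  "degree G v = card {e \<in> edges G. v \<in> e}"

text \<open>In the corona, \<open>Inl v\<close> is the center vertex \<open>v\<close>, and \<open>Inr (v, u)\<close> is the
  vertex \<open>u\<close> of the copy of the outer graph that belongs to \<open>v\<close>.\<close>

definition corona :: "'a ugraph \<Rightarrow> 'b ugraph \<Rightarrow> ('a + 'a \<times> 'b) ugraph" where
  "corona G H =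
    \<lparr> verts = Inl ` verts G \<union> Inr ` (verts G \<times> verts H),
      edges = {Inl ` e | e. e \<in> edges G}
            \<union> {(\<lambda>u. Inr (v, u)) ` e | v e. v \<in> verts G \<and> e \<in> edges H}
            \<union> {{Inl v, Inr (v, u)} | v u. v \<in> verts G \<and> u \<in> verts H} \<rparr>"

text \<open>An orientation is a set of arcs; the arc \<open>(u, v)\<close> leaves \<open>u\<close> and enters \<open>v\<close>.\<close>

definition orientation :: "'a ugraph \<Rightarrow> ('a \<times> 'a) set \<Rightarrow> bool" where
  "orientation G D \<longleftrightarrow>
    (\<forall>u v. (u, v) \<in> D \<longrightarrow> {u, v} \<in> edges G) \<and>
    (\<forall>u v. {u, v} \<in> edges G \<longrightarrow> ((u, v) \<in> D) \<noteq> ((v, u) \<in> D))"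

definition vertex_sum :: "('a \<times> 'a) set \<Rightarrow> ('a set \<Rightarrow> nat) \<Rightarrow> 'a \<Rightarrow> int" where
  "vertex_sum D \<tau> v =
    (\<Sum>u | (u, v) \<in> D. int (\<tau> {u, v})) - (\<Sum>w | (v, w) \<in> D. int (\<tau> {v, w}))"

definition admits_antimagic_orientation :: "'a ugraph \<Rightarrow> bool" where
  "admits_antimagic_orientation F \<longleftrightarrow>
    (\<exists>D \<tau>. orientation F D \<and> bij_betw \<tau> (edges F) {1..card (edges F)} \<and>
       inj_on (vertex_sum D \<tau>) (verts F))"

lemma simple_graph_corona:
  assumes "simple_graph G" "simple_graph H"
  shows "simple_graph (corona G H)"
proof -
  have "card (Inl ` e :: ('a + 'a \<times> 'b) set) = 2" if "e \<in> edges G" for e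
    using assms that by (simp add: simple_graph_def card_image)
  moreover have "card ((\<lambda>u. Inr (v, u)) ` e :: ('a + 'a \<times> 'b) set) = 2"
    if "e \<in> edges H" for v e
    using assms that by (simp add: simple_graph_def card_image inj_on_def)
  ultimately show ?thesis
    using assms by (fastforce simp: simple_graph_def corona_def)
qed

end

theory Submission
  imports Defs
begin

text \<open>
  Call the edges that join a center vertex to its outer copy the spokes, let \<open>u\<^sub>0\<close> be a vertex of
  even degree in the outer graph, and write \<open>n\<close>, \<open>k\<close>, \<open>m\<close>, \<open>h\<close> for the numbers of vertices of \<open>G\<close>
  and \<open>H\<close> and of edges of \<open>G\<close> and \<open>H\<close>. The labels \<open>1..m\<close> go to the edges of \<open>G\<close>, the next \<open>n * h\<close>
  labels to the edges of the outer copies, and the largest \<open>n * k\<close> labels to the spokes, which all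
  point outwards. Spokes then push outer sums up and center sums down, and three things remain.

  Outer sums exceed center sums. This needs the sums inside \<open>G\<close> and inside each copy of \<open>H\<close> to be
  small. A graph can be cut into longest trails (lemma \<open>balanced_arc_ordering\<close>); if its arcs get
  decreasing labels along one trail after another, then at every vertex the entering and leaving arcs
  nearly balance at all times, and summation by parts (lemma \<open>weighted_sum_bound\<close>) shows that the vertex
  sum cannot exceed a small multiple of the largest label, no matter how large the degree is.

  Outer sums differ from each other. Given integer offsets on one set and distinct values on an
  equinumerous one, the values can be distributed such that the totals are distinct: give larger values
  to larger offsets (lemma \<open>bij_making_sums_distinct\<close>). The offsets are the sums inside the copies and
  the values are the spoke labels.

  Center sums differ from each other. At \<open>u\<^sub>0\<close> as many edges of \<open>H\<close> enter as leave. The labels of one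
  edge of \<open>H\<close> in two copies differ by a constant that does not depend on the edge, so the sum at \<open>u\<^sub>0\<close>
  inside a copy is the same in all copies. Permuting the labels of the \<open>n\<close> spokes at the copies of
  \<open>u\<^sub>0\<close> therefore permutes outer sums without changing their set, and a second use of
  \<open>bij_making_sums_distinct\<close> chooses this permutation such that the center sums become distinct.
\<close>

section \<open>Arcs and their contribution to vertex sums\<close>

definition ends :: "'a \<times> 'a \<Rightarrow> 'a set" where
  "ends p = {fst p, snd p}"

definition flux :: "'a \<Rightarrow> 'a \<times> 'a \<Rightarrow> int" where
  "flux v p = of_bool (snd p = v) - of_bool (fst p = v)"

text \<open>In-degree minus out-degree of a vertex in the digraph formed by a list of arcs.\<close>

definition excess :: "('a \<times> 'a) list \<Rightarrow> 'a \<Rightarrow> int" where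
  "excess ps v = (\<Sum>p\<leftarrow>ps. flux v p)"

lemma excess_simps [simp]:
  "excess [] v = 0"
  "excess (p # ps) v = flux v p + excess ps v"
  "excess (ps @ qs) v = excess ps v + excess qs v"
  by (simp_all add: excess_def)

lemma excess_take:
  assumes "j \<le> length ps"
  shows "excess (take j ps) v = (\<Sum>i<j. flux v (ps ! i))"
  using assms
proof (induction j)
  case (Suc j)
  then show ?case by (simp add: take_Suc_conv_app_nth)
qed simp

lemma excess_eq_0: "(\<And>p. p \<in> set ps \<Longrightarrow> v \<notin> ends p) \<Longrightarrow> excess ps v = 0"
  by (induction ps) (auto simp: flux_def ends_def)

text \<open>Each edge at a vertex changes the difference of in-degree and out-degree by \<open>1\<close> or \<open>-1\<close>. For a
  vertex of even degree, \<open>\<bar>excess\<bar> \<le> 1\<close> thus improves to balance.\<close>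

lemma even_excess_iff:
  assumes "distinct (map ends ps)" "\<forall>p\<in>set ps. card (ends p) = 2"
  shows "even (excess ps v) \<longleftrightarrow> even (card {e \<in> ends ` set ps. v \<in> e})"
  using assms
proof (induction ps)
  case (Cons p ps)
  have split: "{e \<in> ends ` set (p # ps). v \<in> e} =
      (if v \<in> ends p then insert (ends p) {e \<in> ends ` set ps. v \<in> e} else {e \<in> ends ` set ps. v \<in> e})"
    by auto
  have "fst p \<noteq> snd p" using Cons.prems by (auto simp: ends_def)
  then have "odd (flux v p) \<longleftrightarrow> v \<in> ends p" by (auto simp: flux_def ends_def)
  moreover have "card (insert (ends p) {e \<in> ends ` set ps. v \<in> e}) = Suc (card {e \<in> ends ` set ps. v \<in> e})"
    using Cons.prems by (intro card_insert_disjoint) auto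
  moreover have "even (excess ps v) \<longleftrightarrow> even (card {e \<in> ends ` set ps. v \<in> e})"
    using Cons by simp
  ultimately show ?case unfolding split by (cases "v \<in> ends p") simp_all
qed simp

section \<open>Decomposition into longest trails\<close>

fun walk :: "'a \<Rightarrow> ('a \<times> 'a) list \<Rightarrow> 'a \<Rightarrow> bool" where
  "walk x [] y \<longleftrightarrow> x = y"
| "walk x (p # ps) y \<longleftrightarrow> fst p = x \<and> walk (snd p) ps y"

lemma walk_append: "walk x (ps @ qs) y \<longleftrightarrow> (\<exists>z. walk x ps z \<and> walk z qs y)"
  by (induction ps arbitrary: x) auto

lemma excess_walk: "walk x ps y \<Longrightarrow> excess ps v = of_bool (y = v) - of_bool (x = v)"
  by (induction ps arbitrary: x) (auto simp: flux_def)

text \<open>A longest trail exhausts the edges at both of its ends, because an unused edge there would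
  prolong it.\<close>

lemma maximal_trail:
  assumes "finite E" "\<forall>e\<in>E. card e = 2" "E \<noteq> {}"
  obtains x y ps where "walk x ps y" "ps \<noteq> []" "distinct (map ends ps)" "ends ` set ps \<subseteq> E"
    "\<And>e. e \<in> E - ends ` set ps \<Longrightarrow> x \<notin> e \<and> y \<notin> e"
proof -
  define trail where "trail ps \<longleftrightarrow>
      (\<exists>x y. walk x ps y) \<and> distinct (map ends ps) \<and> ends ` set ps \<subseteq> E" for ps :: "('a \<times> 'a) list"
  obtain a b where ab: "{a, b} \<in> E"
    using assms(2,3) by (metis card_2_iff equals0I)
  have start: "trail [(a, b)]"
    using ab by (auto simp: trail_def ends_def)
  have "length ps \<le> card E" if "trail ps" for ps
    using that card_mono[OF assms(1), of "ends ` set ps"] distinct_card[of "map ends ps"]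
    by (simp add: trail_def)
  then have "\<exists>ps. trail ps \<and> (\<forall>qs. trail qs \<longrightarrow> length qs \<le> length ps)"
    using ex_has_greatest_nat[of trail, OF start, of length "Suc (card E)"] by (simp add: less_Suc_eq_le)
  then obtain ps where ps: "trail ps" and max: "\<And>qs. trail qs \<Longrightarrow> length qs \<le> length ps"
    by blast
  obtain x y where w: "walk x ps y" using ps by (auto simp: trail_def)
  have "ps \<noteq> []" using max[OF start] by auto
  moreover have "x \<notin> e \<and> y \<notin> e" if e: "e \<in> E - ends ` set ps" for e
  proof (intro conjI notI)
    assume "x \<in> e"
    then obtain z where z: "e = {z, x}"
      using e assms(2) by (metis DiffD1 card_2_iff doubleton_eq_iff insertE singletonD)
    have "walk z ((z, x) # ps) y" using w by simp
    then have "trail ((z, x) # ps)"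
      using ps e z unfolding trail_def by (auto simp: ends_def)
    then show False using max by fastforce
  next
    assume "y \<in> e"
    then obtain z where z: "e = {y, z}"
      using e assms(2) by (metis DiffD1 card_2_iff doubleton_eq_iff insertE singletonD)
    have "walk x (ps @ [(y, z)]) z" using w by (auto simp: walk_append)
    then have "trail (ps @ [(y, z)])"
      using ps e z unfolding trail_def by (auto simp: ends_def)
    then show False using max by fastforce
  qed
  ultimately show ?thesis using that w ps by (auto simp: trail_def)
qed

text \<open>Order the edges outside a longest trail by induction and append the trail. Its two ends had
  excess \<open>0\<close> so far, since all their edges lie on the trail, and the other vertices keep the excess
  that they had. While the trail is being traversed, only its start and its current position deviate,
  by one, from the excess at most \<open>1\<close> left by the induction; this is why prefixes satisfy a bound of
  \<open>2\<close>.\<close>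

lemma balanced_arc_ordering:
  assumes "finite E" "\<forall>e\<in>E. card e = 2"
  shows "\<exists>ps. distinct (map ends ps) \<and> ends ` set ps = E \<and>
    (\<forall>v j. \<bar>excess (take j ps) v\<bar> \<le> 2) \<and> (\<forall>v. \<bar>excess ps v\<bar> \<le> 1)"
  using assms
proof (induction "card E" arbitrary: E rule: less_induct)
  case less
  show ?case
  proof (cases "E = {}")
    case True
    then show ?thesis by (intro exI[of _ "[]"]) simp
  next
    case False
    then obtain x y qs where w: "walk x qs y" and qs: "qs \<noteq> []" "distinct (map ends qs)" "ends ` set qs \<subseteq> E"
      and max: "\<And>e. e \<in> E - ends ` set qs \<Longrightarrow> x \<notin> e \<and> y \<notin> e"
      using maximal_trail[OF less.prems] by metis
    define E' where "E' = E - ends ` set qs"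
    have "E' \<subset> E" using qs by (cases qs) (auto simp: E'_def)
    then have "card E' < card E" using less.prems(1) by (rule psubset_card_mono[rotated])
    then obtain ps where ps: "distinct (map ends ps)" "ends ` set ps = E'"
      "\<And>v j. \<bar>excess (take j ps) v\<bar> \<le> 2" "\<And>v. \<bar>excess ps v\<bar> \<le> 1"
      using less.hyps[of E'] less.prems by (auto simp: E'_def)
    have zero: "excess ps x = 0" "excess ps y = 0"
      using max ps(2) unfolding E'_def by (intro excess_eq_0; blast)+
    have "ends ` set (ps @ qs) = E" using ps(2) qs(3) unfolding E'_def set_append image_Un by blast
    moreover have "distinct (map ends (ps @ qs))" using ps(1,2) qs by (auto simp: E'_def)
    moreover have "\<bar>excess (take j (ps @ qs)) v\<bar> \<le> 2" for v j
    proof (cases "j \<le> length ps")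
      case True
      then show ?thesis using ps(3) by simp
    next
      case False
      obtain z where "walk x (take (j - length ps) qs) z"
        using w by (metis append_take_drop_id walk_append)
      then have "\<bar>excess (take (j - length ps) qs) v\<bar> \<le> 1"
        by (simp add: excess_walk)
      then show ?thesis using ps(4)[of v] False by simp
    qed
    moreover have "\<bar>excess (ps @ qs) v\<bar> \<le> 1" for v
      using ps(4)[of v] zero by (auto simp: excess_walk[OF w])
    ultimately show ?thesis by blast
  qed
qed

section \<open>Bounding and separating sums\<close>

text \<open>Summation by parts for a decreasing weight \<open>L\<close> and a sequence with small partial sums. The term
  \<open>L h\<close> beyond the last weight is split off because the complete sum of the \<open>c i\<close> usually has a better
  bound than the partial sums.\<close>

lemma weighted_sum_bound:
  fixes L c :: "nat \<Rightarrow> int"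
  assumes "\<And>j. j \<le> h \<Longrightarrow> \<bar>\<Sum>i<j. c i\<bar> \<le> B" "\<And>j. j < h \<Longrightarrow> L (Suc j) \<le> L j"
  shows "\<bar>(\<Sum>i<h. L i * c i) - L h * (\<Sum>i<h. c i)\<bar> \<le> B * (L 0 - L h)"
  using assms
proof (induction h)
  case (Suc h)
  let ?D = "\<Sum>i<Suc h. c i"
  have "\<bar>(L h - L (Suc h)) * ?D\<bar> \<le> (L h - L (Suc h)) * B"
    unfolding abs_mult using Suc.prems(1)[of "Suc h"] Suc.prems(2)[of h] by (intro mult_mono) auto
  moreover have "\<bar>(\<Sum>i<h. L i * c i) - L h * (\<Sum>i<h. c i)\<bar> \<le> B * (L 0 - L h)"
    using Suc by simp
  moreover have "(\<Sum>i<Suc h. L i * c i) - L (Suc h) * ?D =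
      ((\<Sum>i<h. L i * c i) - L h * (\<Sum>i<h. c i)) + (L h - L (Suc h)) * ?D"
    by (simp add: algebra_simps)
  ultimately show ?case by (simp add: algebra_simps)
qed simp

text \<open>Match the largest \<open>c x\<close> with the largest \<open>r y\<close>. Their total strictly exceeds every other one,
  since \<open>r\<close> is injective, and induction takes care of the rest.\<close>

lemma bij_making_sums_distinct:
  fixes c :: "'a \<Rightarrow> int" and r :: "'b \<Rightarrow> int"
  assumes "finite A" "finite B" "card A = card B" "inj_on r B"
  shows "\<exists>\<pi>. bij_betw \<pi> A B \<and> inj_on (\<lambda>x. c x + r (\<pi> x)) A"
  using assms
proof (induction "card A" arbitrary: A B)
  case 0
  then show ?case by (auto simp: bij_betw_def)
next
  case (Suc n)
  then have ne: "A \<noteq> {}" "B \<noteq> {}" by auto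
  have "Max (c ` A) \<in> c ` A" using Suc.prems(1) ne by simp
  then obtain a where "a \<in> A" "Max (c ` A) = c a" by blast
  then have a: "a \<in> A" "\<forall>x\<in>A. c x \<le> c a"
    using Suc.prems(1) Max_ge[of "c ` A"] by auto
  have "Max (r ` B) \<in> r ` B" using Suc.prems(2) ne by simp
  then obtain b where "b \<in> B" "Max (r ` B) = r b" by blast
  then have b: "b \<in> B" "\<forall>y\<in>B. r y \<le> r b"
    using Suc.prems(2) Max_ge[of "r ` B"] by auto
  have "\<exists>\<pi>. bij_betw \<pi> (A - {a}) (B - {b}) \<and> inj_on (\<lambda>x. c x + r (\<pi> x)) (A - {a})"
    using Suc a b by (intro Suc.hyps(1)) (auto intro: inj_on_subset)
  then obtain \<pi> where \<pi>: "bij_betw \<pi> (A - {a}) (B - {b})"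
    "inj_on (\<lambda>x. c x + r (\<pi> x)) (A - {a})" by blast
  have less: "c x + r (\<pi> x) < c a + r b" if "x \<in> A - {a}" for x
  proof -
    have "\<pi> x \<in> B - {b}" using \<pi>(1) that by (auto simp: bij_betw_def)
    then have "r (\<pi> x) < r b" using b Suc.prems(4) by (metis DiffD1 DiffD2 inj_onD insertI1 order_le_less)
    then show ?thesis using a that by (simp add: add_le_less_mono)
  qed
  have "bij_betw (\<pi>(a := b)) (insert a (A - {a})) (insert b (B - {b}))"
    using \<pi>(1) by (auto simp: bij_betw_def inj_on_def)
  moreover have "inj_on (\<lambda>x. c x + r ((\<pi>(a := b)) x)) (insert a (A - {a}))"
    using \<pi>(2) less by (fastforce simp: inj_on_def)
  ultimately show ?case using a b by (metis insert_Diff)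
qed

section \<open>Antimagic orientations from labelled arcs\<close>

text \<open>It is easier to label arcs by an index set with an explicit structure than to define an
  orientation and a function on edges: vertex sums become single sums over the index set.\<close>

lemma antimagic_orientation_by_arcs:
  fixes arc :: "'i \<Rightarrow> 'v \<times> 'v" and lab :: "'i \<Rightarrow> nat"
  assumes F: "simple_graph F" and fin: "finite I"
    and edges: "bij_betw (\<lambda>i. ends (arc i)) I (edges F)"
    and labels: "bij_betw lab I {1..card I}"
    and sums: "inj_on (\<lambda>v. \<Sum>i\<in>I. int (lab i) * flux v (arc i)) (verts F)"
  shows "admits_antimagic_orientation F"
proof -
  define D where "D = arc ` I"
  define \<tau> where "\<tau> = lab \<circ> the_inv_into I (\<lambda>i. ends (arc i))"
  have inj: "inj_on (\<lambda>i. ends (arc i)) I" and img: "(\<lambda>i. ends (arc i)) ` I = edges F"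
    using edges by (auto simp: bij_betw_def)
  then have inj_arc: "inj_on arc I" by (metis (mono_tags, lifting) inj_on_def)
  have \<tau>: "\<tau> (ends (arc i)) = lab i" if "i \<in> I" for i
    using that the_inv_into_f_f[OF inj] by (simp add: \<tau>_def)
  have "orientation F D"
    unfolding orientation_def
  proof (intro conjI allI impI)
    fix u v assume "(u, v) \<in> D"
    then obtain i where "i \<in> I" "arc i = (u, v)" by (auto simp: D_def)
    then show "{u, v} \<in> edges F" unfolding img[symmetric] by (force simp: ends_def)
  next
    fix u v assume uv: "{u, v} \<in> edges F"
    then have "u \<noteq> v" using F by (auto simp: simple_graph_def)
    obtain i where i: "i \<in> I" "ends (arc i) = {u, v}"
      using uv unfolding img[symmetric] by (metis (no_types, lifting) imageE)
    then have "arc i = (u, v) \<or> arc i = (v, u)"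
      by (cases "arc i") (auto simp: ends_def doubleton_eq_iff)
    moreover have "\<not> ((u, v) \<in> D \<and> (v, u) \<in> D)"
    proof
      assume "(u, v) \<in> D \<and> (v, u) \<in> D"
      then obtain i j where ij: "i \<in> I" "arc i = (u, v)" "j \<in> I" "arc j = (v, u)"
        unfolding D_def by (metis imageE)
      then have "i = j" using inj by (auto intro!: inj_onD[OF inj] simp: ends_def)
      then show False using ij \<open>u \<noteq> v\<close> by simp
    qed
    ultimately show "((u, v) \<in> D) \<noteq> ((v, u) \<in> D)" using i(1) unfolding D_def by force
  qed
  moreover have "bij_betw \<tau> (edges F) {1..card (edges F)}"
    unfolding \<tau>_def using bij_betw_trans[OF bij_betw_the_inv_into[OF edges] labels]
      bij_betw_same_card[OF edges] by simp
  moreover have "inj_on (vertex_sum D \<tau>) (verts F)"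
  proof -
    have "vertex_sum D \<tau> v = (\<Sum>i\<in>I. int (lab i) * flux v (arc i))" for v
    proof -
      have entering: "(\<Sum>u | (u, v) \<in> D. int (\<tau> {u, v})) = (\<Sum>i | i \<in> I \<and> snd (arc i) = v. int (lab i))"
      proof (rule sum.reindex_cong)
        show "inj_on (\<lambda>i. fst (arc i)) {i \<in> I. snd (arc i) = v}"
          using inj_arc by (auto simp: inj_on_def prod_eq_iff)
        show "{u. (u, v) \<in> D} = (\<lambda>i. fst (arc i)) ` {i \<in> I. snd (arc i) = v}"
          by (auto simp: D_def image_iff prod_eq_iff)
      qed (use \<tau> in \<open>auto simp: ends_def\<close>)
      have leaving: "(\<Sum>w | (v, w) \<in> D. int (\<tau> {v, w})) = (\<Sum>i | i \<in> I \<and> fst (arc i) = v. int (lab i))"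
      proof (rule sum.reindex_cong)
        show "inj_on (\<lambda>i. snd (arc i)) {i \<in> I. fst (arc i) = v}"
          using inj_arc by (auto simp: inj_on_def prod_eq_iff)
        show "{w. (v, w) \<in> D} = (\<lambda>i. snd (arc i)) ` {i \<in> I. fst (arc i) = v}"
          by (auto simp: D_def image_iff prod_eq_iff)
      qed (use \<tau> in \<open>auto simp: ends_def\<close>)
      show ?thesis
        unfolding vertex_sum_def entering leaving sum.inter_filter[OF fin] sum_subtractf[symmetric]
        by (rule sum.cong) (auto simp: flux_def)
    qed
    then show ?thesis
      using sums by (simp add: inj_on_def)
  qed
  ultimately show ?thesis
    unfolding admits_antimagic_orientation_def by blast
qed

section \<open>Arcs, sums and labels of the corona\<close>

text \<open>The three summands index the arcs of the center graph (by position in a list), of the copies of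
  the outer graph (by copy and position), and the spokes (by center vertex and outer vertex).\<close>

definition corona_arcs ::
    "'a ugraph \<Rightarrow> 'b ugraph \<Rightarrow> nat \<Rightarrow> nat \<Rightarrow> (nat + 'a \<times> nat + 'a \<times> 'b) set" where
  "corona_arcs G H m h = {..<m} <+> verts G \<times> {..<h} <+> verts G \<times> verts H"

fun corona_arc :: "('a \<times> 'a) list \<Rightarrow> ('b \<times> 'b) list \<Rightarrow> nat + 'a \<times> nat + 'a \<times> 'b
    \<Rightarrow> ('a + 'a \<times> 'b) \<times> ('a + 'a \<times> 'b)" where
  "corona_arc xs ys (Inl j) = (Inl (fst (xs ! j)), Inl (snd (xs ! j)))"
| "corona_arc xs ys (Inr (Inl (v, j))) = (Inr (v, fst (ys ! j)), Inr (v, snd (ys ! j)))"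
| "corona_arc xs ys (Inr (Inr (v, u))) = (Inl v, Inr (v, u))"

lemma ends_corona_arc:
  "ends (corona_arc xs ys (Inl j)) = Inl ` ends (xs ! j)"
  "ends (corona_arc xs ys (Inr (Inl (v, j)))) = (\<lambda>u. Inr (v, u)) ` ends (ys ! j)"
  "ends (corona_arc xs ys (Inr (Inr (v, u)))) = {Inl v, Inr (v, u)}"
  by (auto simp: ends_def)

lemma corona_arcs_orient_edges:
  assumes xs: "distinct (map ends xs)" "ends ` set xs = edges G"
    and ys: "distinct (map ends ys)" "ends ` set ys = edges H"
  shows "bij_betw (\<lambda>i. ends (corona_arc xs ys i)) (corona_arcs G H (length xs) (length ys))
    (edges (corona G H))"
proof -
  have inj: "ends (ps ! i) = ends (ps ! j) \<Longrightarrow> i = j"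
    if "distinct (map ends ps)" "i < length ps" "j < length ps" for i j and ps :: "('c \<times> 'c) list"
    using that by (metis distinct_conv_nth length_map nth_map)
  have fiber: "(\<lambda>u. Inr (v, u)) ` ends p = (\<lambda>u. Inr (w, u) :: 'a + 'a \<times> 'b) ` ends q
      \<longleftrightarrow> v = w \<and> ends p = ends q" for v w p q
    by (auto simp: ends_def doubleton_eq_iff)
  have list: "ends ` set ps = (\<lambda>j. ends (ps ! j)) ` {..<length ps}" for ps :: "('c \<times> 'c) list"
    by (auto simp: set_conv_nth)
  have cross: "Inl ` ends p \<noteq> (\<lambda>u. Inr (v, u)) ` ends q" "Inl ` ends p \<noteq> {Inl w, Inr y}"
    "(\<lambda>u. Inr (v, u)) ` ends q \<noteq> {Inl w, Inr y}"
    for p :: "'a \<times> 'a" and q :: "'b \<times> 'b" and v w :: 'a and y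
    by (auto simp: ends_def doubleton_eq_iff)
  have center: "(Inl ` A :: ('a + 'a \<times> 'b) set) = Inl ` B \<longleftrightarrow> A = B" for A B
    by (simp add: inj_image_eq_iff)
  have "inj_on (\<lambda>i. ends (corona_arc xs ys i)) (corona_arcs G H (length xs) (length ys))"
  proof (rule inj_onI)
    fix i j
    assume "i \<in> corona_arcs G H (length xs) (length ys)" "j \<in> corona_arcs G H (length xs) (length ys)"
      "ends (corona_arc xs ys i) = ends (corona_arc xs ys j)"
    then show "i = j"
      by (cases "(xs, ys, i)" rule: corona_arc.cases; cases "(xs, ys, j)" rule: corona_arc.cases)
        (auto simp: corona_arcs_def ends_corona_arc center fiber cross cross[symmetric] doubleton_eq_iff
           simp del: corona_arc.simps dest: inj[OF xs(1)] inj[OF ys(1)])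
  qed
  moreover have "(\<lambda>i. ends (corona_arc xs ys i)) ` corona_arcs G H (length xs) (length ys) =
      (\<lambda>e. Inl ` e) ` edges G \<union> (\<lambda>(v, e). (\<lambda>u. Inr (v, u)) ` e) ` (verts G \<times> edges H)
      \<union> (\<lambda>(v, u). {Inl v, Inr (v, u)}) ` (verts G \<times> verts H)"
    unfolding xs(2)[symmetric] ys(2)[symmetric] list corona_arcs_def
    unfolding Plus_def image_Un image_image Un_assoc
    by (intro arg_cong2[of _ _ _ _ "(\<union>)"] refl set_eqI)
      (auto simp: ends_corona_arc image_iff Bex_def simp del: corona_arc.simps)
  moreover have "\<dots> = edges (corona G H)"
    by (auto simp: corona_def)
  ultimately show ?thesis by (simp add: bij_betw_def)
qed

lemma corona_sums:
  fixes L :: "nat + 'a \<times> nat + 'a \<times> 'b \<Rightarrow> int"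
  assumes "finite (verts G)" "finite (verts H)" "w \<in> verts G"
  shows "(\<Sum>i\<in>corona_arcs G H m h. L i * flux (Inl w) (corona_arc xs ys i)) =
      (\<Sum>j<m. L (Inl j) * flux w (xs ! j)) - (\<Sum>u\<in>verts H. L (Inr (Inr (w, u))))"
    and "u \<in> verts H \<Longrightarrow>
      (\<Sum>i\<in>corona_arcs G H m h. L i * flux (Inr (w, u)) (corona_arc xs ys i)) =
      (\<Sum>j<h. L (Inr (Inl (w, j))) * flux u (ys ! j)) + L (Inr (Inr (w, u)))"
proof -
  have split: "(\<Sum>i\<in>corona_arcs G H m h. f i) =
      (\<Sum>j<m. f (Inl j)) + (\<Sum>v\<in>verts G. \<Sum>j<h. f (Inr (Inl (v, j)))) +
      (\<Sum>v\<in>verts G. \<Sum>u\<in>verts H. f (Inr (Inr (v, u))))" for f :: "_ \<Rightarrow> int"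
    using assms(1,2) by (simp add: corona_arcs_def sum.Plus sum.cartesian_product)
  have fluxes:
    "flux (Inl w) (corona_arc xs ys (Inl j)) = flux w (xs ! j)"
    "flux (Inl w) (corona_arc xs ys (Inr (Inl (v, j)))) = 0"
    "flux (Inl w) (corona_arc xs ys (Inr (Inr (v, u')))) = - of_bool (v = w)"
    "flux (Inr (w, u)) (corona_arc xs ys (Inl j)) = 0"
    "flux (Inr (w, u)) (corona_arc xs ys (Inr (Inl (v, j)))) = of_bool (v = w) * flux u (ys ! j)"
    "flux (Inr (w, u)) (corona_arc xs ys (Inr (Inr (v, u')))) = of_bool (v = w) * of_bool (u' = u)"
    for v j u u' by (auto simp: flux_def)
  have pick: "(\<Sum>v\<in>verts G. f v * of_bool (v = w)) = f w" for f :: "'a \<Rightarrow> int"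
    using assms(1,3) by (simp add: of_bool_def if_distrib cong: if_cong)
  have pick': "(\<Sum>u'\<in>verts H. f u' * of_bool (u' = u)) = f u" if "u \<in> verts H" for f :: "'b \<Rightarrow> int" and u
    using assms(2) that by (simp add: of_bool_def if_distrib cong: if_cong)
  have "(\<Sum>v\<in>verts G. \<Sum>u\<in>verts H. L (Inr (Inr (v, u))) * - of_bool (v = w)) =
      - (\<Sum>u\<in>verts H. L (Inr (Inr (w, u))))"
    using pick[of "\<lambda>v. \<Sum>u\<in>verts H. L (Inr (Inr (v, u)))"] by (simp add: sum_distrib_right sum_negf)
  then show "(\<Sum>i\<in>corona_arcs G H m h. L i * flux (Inl w) (corona_arc xs ys i)) =
      (\<Sum>j<m. L (Inl j) * flux w (xs ! j)) - (\<Sum>u\<in>verts H. L (Inr (Inr (w, u))))"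
    unfolding split fluxes by simp
  assume u: "u \<in> verts H"
  have "(\<Sum>v\<in>verts G. \<Sum>j<h. L (Inr (Inl (v, j))) * (of_bool (v = w) * flux u (ys ! j))) =
      (\<Sum>j<h. L (Inr (Inl (w, j))) * flux u (ys ! j))"
    by (subst pick[symmetric], rule sum.cong) auto
  moreover have "(\<Sum>v\<in>verts G. \<Sum>u'\<in>verts H. L (Inr (Inr (v, u'))) * (of_bool (v = w) * of_bool (u' = u))) =
      L (Inr (Inr (w, u)))"
    by (subst pick'[OF u, symmetric], subst pick[symmetric], rule sum.cong) auto
  ultimately show "(\<Sum>i\<in>corona_arcs G H m h. L i * flux (Inr (w, u)) (corona_arc xs ys i)) =
      (\<Sum>j<h. L (Inr (Inl (w, j))) * flux u (ys ! j)) + L (Inr (Inr (w, u)))"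
    unfolding split fluxes by simp
qed

text \<open>\<open>\<iota>\<close> numbers the copies of the outer graph from \<open>0\<close>, and \<open>l\<close> numbers the spokes from \<open>1\<close>. Labels
  decrease with the position in a list, as \<open>weighted_sum_bound\<close> requires. The labels of one outer edge in
  the \<open>n\<close> copies form a block of \<open>n\<close> consecutive numbers, and in each block the copy \<open>v\<close> uses the offset
  \<open>\<iota> v\<close>; hence changing the copy adds the same constant to all labels.\<close>

fun corona_label :: "nat \<Rightarrow> nat \<Rightarrow> nat \<Rightarrow> ('a \<Rightarrow> nat) \<Rightarrow> ('a \<times> 'b \<Rightarrow> nat)
    \<Rightarrow> nat + 'a \<times> nat + 'a \<times> 'b \<Rightarrow> nat" where
  "corona_label m n h \<iota> l (Inl j) = m - j"
| "corona_label m n h \<iota> l (Inr (Inl (v, j))) = m + (n * (h - 1 - j) + \<iota> v) + 1"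
| "corona_label m n h \<iota> l (Inr (Inr p)) = m + n * h + l p"

lemma bij_betw_corona_label:
  assumes fin: "finite (verts G)" "finite (verts H)"
    and \<iota>: "bij_betw \<iota> (verts G) {..<card (verts G)}"
    and l: "bij_betw l (verts G \<times> verts H) {1..card (verts G \<times> verts H)}"
  shows "bij_betw (corona_label m (card (verts G)) h \<iota> l) (corona_arcs G H m h)
    {1..card (corona_arcs G H m h)}"
proof -
  define n where "n = card (verts G)"
  let ?I = "corona_arcs G H m h" and ?f = "corona_label m n h \<iota> l"
  have card: "card ?I = m + n * h + card (verts G \<times> verts H)"
    using fin by (simp add: corona_arcs_def card_Plus n_def)
  have \<iota>_less: "\<iota> v < n" if "v \<in> verts G" for v
    using \<iota> that by (auto simp: bij_betw_def n_def)
  have copy_less: "n * (h - 1 - j) + \<iota> v < n * h" if "v \<in> verts G" "j < h" for v j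
  proof -
    have "n * (h - 1 - j) + \<iota> v < n * Suc (h - 1 - j)" using \<iota>_less[OF that(1)] by simp
    also have "\<dots> \<le> n * h" using that(2) by (intro mult_le_mono2) simp
    finally show ?thesis .
  qed
  \<comment> \<open>Block and offset are the quotient and the remainder modulo \<open>n\<close>.\<close>
  have copy_inj: "v = w \<and> i = j"
    if "v \<in> verts G" "w \<in> verts G" "i < h" "j < h"
      "n * (h - 1 - i) + \<iota> v = n * (h - 1 - j) + \<iota> w" for v w i j
  proof -
    have "(n * (h - 1 - i) + \<iota> v) div n = (n * (h - 1 - j) + \<iota> w) div n"
      "(n * (h - 1 - i) + \<iota> v) mod n = (n * (h - 1 - j) + \<iota> w) mod n"
      using that by simp_all
    then have "h - 1 - i = h - 1 - j" "\<iota> v = \<iota> w"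
      using \<iota>_less[OF that(1)] \<iota>_less[OF that(2)] by simp_all
    then show ?thesis using that \<iota> by (auto simp: bij_betw_def inj_on_def)
  qed
  have l_range: "1 \<le> l p \<and> l p \<le> card (verts G \<times> verts H)" if "p \<in> verts G \<times> verts H" for p
    using l that by (auto simp: bij_betw_def)
  have l_inj: "v = w \<and> t = u"
    if "v \<in> verts G" "t \<in> verts H" "w \<in> verts G" "u \<in> verts H" "l (v, t) = l (w, u)" for v w t u
    using l that by (auto simp: bij_betw_def inj_on_def)
  have bounds: "case i of Inl j \<Rightarrow> 1 \<le> ?f i \<and> ?f i \<le> m
      | Inr (Inl _) \<Rightarrow> m < ?f i \<and> ?f i \<le> m + n * h
      | Inr (Inr _) \<Rightarrow> m + n * h < ?f i \<and> ?f i \<le> card ?I" if "i \<in> ?I" for i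
  proof (cases "(m, n, h, \<iota>, l, i)" rule: corona_label.cases)
    case (1 m' n' h' \<iota>' l' j)
    then show ?thesis using that by (auto simp: corona_arcs_def)
  next
    case (2 m' n' h' \<iota>' l' v j)
    then show ?thesis using that copy_less[of v j] by (auto simp: corona_arcs_def)
  next
    case (3 m' n' h' \<iota>' l' p)
    then show ?thesis using that l_range[of p] card by (auto simp: corona_arcs_def)
  qed
  have "inj_on ?f ?I"
  proof (rule inj_onI)
    fix i j assume ij: "i \<in> ?I" "j \<in> ?I" "?f i = ?f j"
    show "i = j"
      using ij(3) bounds[OF ij(1)] bounds[OF ij(2)] ij(1,2)
      by (auto split: sum.splits simp: corona_arcs_def dest: copy_inj l_inj)
  qed
  moreover have "?f ` ?I \<subseteq> {1..card ?I}"
    using bounds card by (fastforce split: sum.splits)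
  moreover have "finite ?I" using fin by (simp add: corona_arcs_def)
  ultimately show ?thesis
    unfolding n_def[symmetric] bij_betw_def by (simp add: card_image card_subset_eq)
qed

section \<open>The antimagic orientation\<close>

theorem theorem4p1:
  fixes G :: "'a ugraph" and H :: "'b ugraph"
  assumes "simple_graph G" and "simple_graph H"
    and "\<exists>u \<in> verts H. even (degree H u)"
  shows "admits_antimagic_orientation (corona G H)"
proof -
  obtain u0 where u0: "u0 \<in> verts H" "even (degree H u0)" using assms(3) by blast
  have fin: "finite (verts G)" "finite (verts H)"
    using assms(1,2) by (auto simp: simple_graph_def)
  have card2: "\<forall>e\<in>edges G. card e = 2" "\<forall>e\<in>edges H. card e = 2"
    using assms(1,2) by (auto simp: simple_graph_def)
  have "edges G \<subseteq> Pow (verts G)" "edges H \<subseteq> Pow (verts H)"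
    using assms(1,2) by (auto simp: simple_graph_def)
  then have fin_edges: "finite (edges G)" "finite (edges H)"
    using fin by (auto intro: finite_subset)
  obtain xs where xs: "distinct (map ends xs)" "ends ` set xs = edges G"
    "\<And>v j. \<bar>excess (take j xs) v\<bar> \<le> 2"
    using balanced_arc_ordering[OF fin_edges(1) card2(1)] by blast
  obtain ys where ys: "distinct (map ends ys)" "ends ` set ys = edges H"
    "\<And>v j. \<bar>excess (take j ys) v\<bar> \<le> 2" "\<And>v. \<bar>excess ys v\<bar> \<le> 1"
    using balanced_arc_ordering[OF fin_edges(2) card2(2)] by blast
  define n k m h where "n = card (verts G)" "k = card (verts H)" "m = length xs" "h = length ys"
  note defs = n_k_m_h_def
  define M where "M = m + n * h"
  obtain \<iota> where \<iota>: "bij_betw \<iota> (verts G) {..<n}"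
    using fin(1) unfolding defs by (metis atLeast0LessThan ex_bij_betw_finite_nat)
  have \<iota>_less: "\<iota> v < n" if "v \<in> verts G" for v
    using \<iota> that by (auto simp: bij_betw_def)

  \<comment> \<open>\<open>C\<close> and \<open>S\<close> are the vertex sums inside the center graph and inside the outer copies, without
    the spokes.\<close>
  define C :: "'a \<Rightarrow> int" where "C v = (\<Sum>j<m. int (m - j) * flux v (xs ! j))" for v
  define S :: "'a \<times> 'b \<Rightarrow> int" where
    "S = (\<lambda>(v, u). \<Sum>j<h. int (m + (n * (h - 1 - j) + \<iota> v) + 1) * flux u (ys ! j))"
  have C_le: "C v \<le> 2 * int m" for v
  proof -
    have "\<bar>(\<Sum>j<m. int (m - j) * flux v (xs ! j)) - int (m - m) * (\<Sum>j<m. flux v (xs ! j))\<bar>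
        \<le> 2 * (int (m - 0) - int (m - m))"
      by (rule weighted_sum_bound) (use xs(3) in \<open>auto simp: defs excess_take[symmetric]\<close>)
    then show ?thesis by (simp add: C_def)
  qed
  \<comment> \<open>The bound \<open>2\<close> on prefixes doubles only the drop \<open>n * h\<close> of the labels along the list. The \<open>m\<close>
    labels below them, already spent on the center graph, count only once because the final excess
    is at most \<open>1\<close>.\<close>
  have S_ge: "S (v, u) \<ge> - int (m + n + 2 * n * h)" if "v \<in> verts G" for v u
  proof -
    \<comment> \<open>Computed in the integers, the label formula extends to the position \<open>h\<close>.\<close>
    define L where "L j = int m + int n * (int h - 1 - int j) + int (\<iota> v) + 1" for j :: nat
    let ?D = "\<Sum>j<h. flux u (ys ! j)"
    have "S (v, u) = (\<Sum>j<h. L j * flux u (ys ! j))"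
      unfolding S_def L_def by (auto intro!: sum.cong)
    moreover have "\<bar>(\<Sum>j<h. L j * flux u (ys ! j)) - L h * ?D\<bar> \<le> 2 * (L 0 - L h)"
      by (rule weighted_sum_bound)
        (use ys(3) in \<open>auto simp: defs L_def excess_take[symmetric] algebra_simps\<close>)
    moreover have "L 0 - L h = int (n * h)" by (simp add: L_def algebra_simps)
    moreover have "\<bar>?D\<bar> \<le> 1"
      using ys(4)[of u] excess_take[of h ys u] by (simp add: defs)
    moreover have "\<bar>L h\<bar> \<le> int (m + n)"
      using \<iota>_less[OF that] by (simp add: L_def algebra_simps)
    ultimately show ?thesis
      using abs_mult[of "L h" ?D] mult_mono[of "\<bar>L h\<bar>" "int (m + n)" "\<bar>?D\<bar>" 1] by simp
  qed
  have S_u0: "S (v, u0) = S (w, u0)" for v w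
  proof -
    have "\<forall>p\<in>set ys. card (ends p) = 2" using ys(2) card2(2) by blast
    then have "even (excess ys u0)"
      using even_excess_iff[OF ys(1)] u0(2) by (simp add: ys(2) degree_def)
    then have "excess ys u0 = 0" using ys(4)[of u0] by (auto elim!: evenE)
    then have zero: "(\<Sum>j<h. flux u0 (ys ! j)) = 0"
      using excess_take[of h ys u0] by (simp add: defs)
    have "S (v, u0) = (\<Sum>j<h. int (m + n * (h - 1 - j) + 1) * flux u0 (ys ! j))
        + int (\<iota> v) * (\<Sum>j<h. flux u0 (ys ! j))" for v
      by (simp add: S_def sum_distrib_left sum.distrib[symmetric] algebra_simps)
    then show ?thesis using zero by simp
  qed

  \<comment> \<open>First distribute the spoke labels such that the outer sums are distinct.\<close>
  obtain l0 where l0: "bij_betw l0 (verts G \<times> verts H) {1..card (verts G \<times> verts H)}"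
    "inj_on (\<lambda>p. S p + int (l0 p)) (verts G \<times> verts H)"
    using bij_making_sums_distinct[of "verts G \<times> verts H" "{1..card (verts G \<times> verts H)}" int S] fin
    by auto
  have l0_inj: "inj_on l0 (verts G \<times> verts H)" using l0(1) by (simp add: bij_betw_def)
  \<comment> \<open>Then redistribute the labels of the spokes at the copies of \<open>u0\<close> among themselves, using as
    offset \<open>c v\<close> the part of the center sum at \<open>v\<close> that this does not affect.\<close>
  define c where "c v = C v - (\<Sum>u\<in>verts H - {u0}. int (M + l0 (v, u)))" for v
  have "inj_on (\<lambda>v. - int (l0 (v, u0))) (verts G)"
    using l0_inj u0(1) by (auto simp: inj_on_def)
  then obtain \<pi> where \<pi>: "bij_betw \<pi> (verts G) (verts G)"
    "inj_on (\<lambda>v. c v + - int (l0 (\<pi> v, u0))) (verts G)"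
    using bij_making_sums_distinct[OF fin(1) fin(1) refl, of "\<lambda>v. - int (l0 (v, u0))" c] by blast
  define \<sigma> where "\<sigma> = (\<lambda>(v, u). (if u = u0 then \<pi> v else v, u))"
  have "bij_betw \<sigma> (verts G \<times> verts H) (verts G \<times> verts H)"
  proof -
    have "\<sigma> ` (verts G \<times> verts H) \<subseteq> verts G \<times> verts H" "inj_on \<sigma> (verts G \<times> verts H)"
      using \<pi>(1) by (auto simp: \<sigma>_def bij_betw_def inj_on_def split: if_splits)
    then show ?thesis using fin by (simp add: bij_betw_def endo_inj_surj)
  qed
  note \<sigma> = this
  define l where "l = l0 \<circ> \<sigma>"
  have l: "bij_betw l (verts G \<times> verts H) {1..card (verts G \<times> verts H)}"
    unfolding l_def using \<sigma> l0(1) by (rule bij_betw_trans)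
  have S_\<sigma>: "S (\<sigma> p) = S p" for p
    using S_u0 by (cases p) (auto simp: \<sigma>_def)
  \<comment> \<open>The new outer sum at \<open>p\<close> is the old one at \<open>\<sigma> p\<close>.\<close>
  have outer: "inj_on (\<lambda>p. S p + int (M + l p)) (verts G \<times> verts H)"
  proof (rule inj_onI)
    fix p q assume pq: "p \<in> verts G \<times> verts H" "q \<in> verts G \<times> verts H"
      "S p + int (M + l p) = S q + int (M + l q)"
    then have "S (\<sigma> p) + int (l0 (\<sigma> p)) = S (\<sigma> q) + int (l0 (\<sigma> q))"
      by (simp add: S_\<sigma> l_def)
    moreover have "\<sigma> p \<in> verts G \<times> verts H" "\<sigma> q \<in> verts G \<times> verts H"
      using \<sigma> pq(1,2) by (auto simp: bij_betw_def)
    ultimately have "\<sigma> p = \<sigma> q" using l0(2) by (auto dest: inj_onD)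
    then show "p = q" using \<sigma> pq(1,2) by (auto simp: bij_betw_def dest: inj_onD)
  qed
  have "C v - (\<Sum>u\<in>verts H. int (M + l (v, u))) = c v + - int (l0 (\<pi> v, u0)) - int M" for v
  proof -
    have "(\<Sum>u\<in>verts H. int (M + l (v, u))) =
        int (M + l (v, u0)) + (\<Sum>u\<in>verts H - {u0}. int (M + l (v, u)))"
      using fin(2) u0(1) by (rule sum.remove)
    also have "(\<Sum>u\<in>verts H - {u0}. int (M + l (v, u))) = (\<Sum>u\<in>verts H - {u0}. int (M + l0 (v, u)))"
      by (rule sum.cong) (auto simp: l_def \<sigma>_def)
    finally show ?thesis by (simp add: c_def l_def \<sigma>_def)
  qed
  then have inner: "inj_on (\<lambda>v. C v - (\<Sum>u\<in>verts H. int (M + l (v, u)))) (verts G)"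
    using \<pi>(2) by (simp add: inj_on_def)
  have separated: "C w - (\<Sum>u\<in>verts H. int (M + l (w, u))) < S (v, u) + int (M + l (v, u))"
    if "w \<in> verts G" "v \<in> verts G" "u \<in> verts H" for w v u
  proof -
    have pos: "l (x, y) \<ge> 1" if "x \<in> verts G" "y \<in> verts H" for x y
      using l that by (auto simp: bij_betw_def)
    have "(\<Sum>u\<in>verts H. int (M + 1)) \<le> (\<Sum>u\<in>verts H. int (M + l (w, u)))"
      using pos that(1) by (intro sum_mono) simp
    then have low: "int k * int (M + 1) \<le> (\<Sum>u\<in>verts H. int (M + l (w, u)))"
      by (simp add: defs)
    show ?thesis
    proof (cases "h = 0")
      \<comment> \<open>Without edges in \<open>H\<close> one spoke at \<open>w\<close> suffices.\<close>
      case True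
      then have "S (v, u) = 0" by (simp add: S_def)
      moreover have "k \<ge> 1" using that(3) fin(2) by (auto simp: defs Suc_le_eq card_gt_0_iff)
      then have one_label: "int 1 * int (M + 1) \<le> int k * int (M + 1)" by (intro mult_right_mono) auto
      have "int M + 1 \<le> (\<Sum>u\<in>verts H. int (M + l (w, u)))"
        using order_trans[OF one_label low] by simp
      moreover have "int M = int m" using True by (simp add: M_def)
      moreover have "int M + 1 \<le> int (M + l (v, u))" using pos[OF that(2,3)] by simp
      ultimately show ?thesis using C_le[of w] by linarith
    next
      \<comment> \<open>An edge in \<open>H\<close> provides two vertices, hence two spokes at \<open>w\<close>: their labels beat
        the possibly negative sum inside a copy.\<close>
      case False
      then obtain p where "p \<in> set ys" by (metis defs(4) length_0_conv list.set_intros(1) neq_Nil_conv)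
      then have "ends p \<in> edges H" using ys(2) by blast
      then have "ends p \<subseteq> verts H" "card (ends p) = 2" using assms(2) by (auto simp: simple_graph_def)
      then have "2 \<le> k" using card_mono[OF fin(2)] by (metis defs(2))
      then have two_labels: "int 2 * int (M + 1) \<le> int k * int (M + 1)" by (intro mult_right_mono) auto
      have "2 * int M + 2 \<le> (\<Sum>u\<in>verts H. int (M + l (w, u)))"
        using order_trans[OF two_labels low] by simp
      moreover have "int n \<le> int (n * h)" unfolding of_nat_le_iff using False by simp
      moreover have "int M = int m + int (n * h)" by (simp add: M_def)
      moreover have "S (v, u) \<ge> - (int m + int n + 2 * int (n * h))"
        using S_ge[OF that(2), of u] by simp
      moreover have "S (v, u) + int M + 1 \<le> S (v, u) + int (M + l (v, u))"
        using pos[OF that(2,3)] by simp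
      ultimately show ?thesis using C_le[of w] by linarith
    qed
  qed

  let ?I = "corona_arcs G H m h"
  let ?s = "\<lambda>x. \<Sum>i\<in>?I. int (corona_label m n h \<iota> l i) * flux x (corona_arc xs ys i)"
  have center_sum: "?s (Inl v) = C v - (\<Sum>u\<in>verts H. int (M + l (v, u)))" if "v \<in> verts G" for v
    unfolding corona_sums(1)[OF fin that] by (simp add: C_def M_def)
  have outer_sum: "?s (Inr (v, u)) = S (v, u) + int (M + l (v, u))"
    if "v \<in> verts G" "u \<in> verts H" for v u
    unfolding corona_sums(2)[OF fin that] by (simp add: S_def M_def)
  show ?thesis
  proof (rule antimagic_orientation_by_arcs)
    show "simple_graph (corona G H)" using assms(1,2) by (rule simple_graph_corona)
    show "finite ?I" using fin by (simp add: corona_arcs_def)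
    show "bij_betw (\<lambda>i. ends (corona_arc xs ys i)) ?I (edges (corona G H))"
      using corona_arcs_orient_edges[OF xs(1,2) ys(1,2)] by (simp add: defs)
    show "bij_betw (corona_label m n h \<iota> l) ?I {1..card ?I}"
      using bij_betw_corona_label[OF fin _ l] \<iota> by (simp add: defs)
    show "inj_on ?s (verts (corona G H))"
    proof (rule inj_onI)
      fix x y assume xy: "x \<in> verts (corona G H)" "y \<in> verts (corona G H)" "?s x = ?s y"
      have vertex: "(\<exists>v\<in>verts G. z = Inl v) \<or> (\<exists>v\<in>verts G. \<exists>u\<in>verts H. z = Inr (v, u))"
        if "z \<in> verts (corona G H)" for z
        using that by (auto simp: corona_def)
      show "x = y"
        using vertex[OF xy(1)] vertex[OF xy(2)]
      proof (elim disjE bexE)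
        fix v w assume *: "v \<in> verts G" "w \<in> verts G" "x = Inl v" "y = Inl w"
        then show ?thesis using xy(3) inner by (auto simp: center_sum dest: inj_onD)
      next
        fix v u w assume *: "w \<in> verts G" "v \<in> verts G" "u \<in> verts H" "x = Inl w" "y = Inr (v, u)"
        then show ?thesis using xy(3) separated[OF *(1-3)] by (simp add: center_sum outer_sum)
      next
        fix v u w assume *: "w \<in> verts G" "v \<in> verts G" "u \<in> verts H" "x = Inr (v, u)" "y = Inl w"
        then show ?thesis using xy(3) separated[OF *(1-3)] by (simp add: center_sum outer_sum)
      next
        fix v u w t
        assume *: "v \<in> verts G" "u \<in> verts H" "x = Inr (v, u)" "w \<in> verts G" "t \<in> verts H" "y = Inr (w, t)"
        then show ?thesis using xy(3) inj_onD[OF outer, of "(v, u)" "(w, t)"] by (simp add: outer_sum)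
      qed
    qed
  qed
qed

end
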